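(* Let $R$ be a regular left fusible ring having a classical left quotient ring, and let $n\geq 1$ be an integer. Then the matrix ring $M_n(R)$ of $n\times n$ matrices over $R$ is regular left fusible.
   Context: All rings are associative with unity (not necessarily commutative). For $A\subseteq R$ nonempty, $\mathrm{lann}_R(A)=\{r\in R\mid rA=0\}$. An element $a\in R$ is a left zero-divisor if $\mathrm{lann}_R(a)\neq 0$; it is left regular if $\mathrm{lann}_R(a)=0$. An element is regular if it is both left and right regular (right regular: $ar=0$ implies $r=0$). A nonzero element $r\in R$ is left fusible if $r=c+w$ for some left zero-divisor $c$ and some left regular element $w$ of $R$. A ring $R$ is regular left fusible if for every nonzero $r\in R$ there exists a regular element $s\in R$ such that $sr$ is left fusible. The classical left quotient ring of $R$ is the left Ore localization of $R$ at the set of all regular elements of $R$ (it exists exactly when this set is a left Ore set). *)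

theory Defs
  imports "Jordan_Normal_Form.Matrix" "HOL-Algebra.AbelCoset"
begin

(* The HOL-Algebra predicate ring means: associative, with unity, not necessarily
   commutative; the zero ring is allowed. *)

definition lann :: "('a, 'm) ring_scheme \<Rightarrow> 'a set \<Rightarrow> 'a set" where
  "lann R A = {r \<in> carrier R. \<forall>a\<in>A. r \<otimes>\<^bsub>R\<^esub> a = \<zero>\<^bsub>R\<^esub>}"

definition left_zero_divisor :: "('a, 'm) ring_scheme \<Rightarrow> 'a \<Rightarrow> bool" where
  "left_zero_divisor R a \<longleftrightarrow> a \<in> carrier R \<and> lann R {a} \<noteq> {\<zero>\<^bsub>R\<^esub>}"

definition left_regular :: "('a, 'm) ring_scheme \<Rightarrow> 'a \<Rightarrow> bool" where
  "left_regular R a \<longleftrightarrow> a \<in> carrier R \<and> lann R {a} = {\<zero>\<^bsub>R\<^esub>}"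

definition right_regular :: "('a, 'm) ring_scheme \<Rightarrow> 'a \<Rightarrow> bool" where
  "right_regular R a \<longleftrightarrow> a \<in> carrier R \<and>
     (\<forall>r\<in>carrier R. a \<otimes>\<^bsub>R\<^esub> r = \<zero>\<^bsub>R\<^esub> \<longrightarrow> r = \<zero>\<^bsub>R\<^esub>)"

definition regular :: "('a, 'm) ring_scheme \<Rightarrow> 'a \<Rightarrow> bool" where
  "regular R a \<longleftrightarrow> left_regular R a \<and> right_regular R a"

definition left_fusible :: "('a, 'm) ring_scheme \<Rightarrow> 'a \<Rightarrow> bool" where
  "left_fusible R r \<longleftrightarrow> r \<in> carrier R \<and> r \<noteq> \<zero>\<^bsub>R\<^esub> \<and>
     (\<exists>c w. left_zero_divisor R c \<and> left_regular R w \<and> r = c \<oplus>\<^bsub>R\<^esub> w)"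

definition regular_left_fusible_ring :: "('a, 'm) ring_scheme \<Rightarrow> bool" where
  "regular_left_fusible_ring R \<longleftrightarrow> ring R \<and>
     (\<forall>r\<in>carrier R. r \<noteq> \<zero>\<^bsub>R\<^esub> \<longrightarrow>
        (\<exists>s. regular R s \<and> left_fusible R (s \<otimes>\<^bsub>R\<^esub> r)))"

(* Q together with f is a left Ore localization of R at S, i.e. a left ring of
   fractions S^(-1) R: f is S-inverting, every element of Q is a left fraction
   f(s)^(-1) f(r), and the kernel of f is the S-torsion of R. *)
definition left_Ore_localization ::
  "('a, 'm) ring_scheme \<Rightarrow> 'a set \<Rightarrow> ('q, 'k) ring_scheme \<Rightarrow> ('a \<Rightarrow> 'q) \<Rightarrow> bool" where
  "left_Ore_localization R S Q f \<longleftrightarrow>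
     ring R \<and> ring Q \<and> f \<in> ring_hom R Q \<and>
     f ` S \<subseteq> Units Q \<and>
     (\<forall>q\<in>carrier Q. \<exists>s\<in>S. \<exists>r\<in>carrier R. q = inv\<^bsub>Q\<^esub> (f s) \<otimes>\<^bsub>Q\<^esub> f r) \<and>
     a_kernel R Q f = {r \<in> carrier R. \<exists>s\<in>S. s \<otimes>\<^bsub>R\<^esub> r = \<zero>\<^bsub>R\<^esub>}"

definition classical_left_quotient_ring ::
  "('a, 'm) ring_scheme \<Rightarrow> ('q, 'k) ring_scheme \<Rightarrow> ('a \<Rightarrow> 'q) \<Rightarrow> bool" where
  "classical_left_quotient_ring R Q f \<longleftrightarrow>
     left_Ore_localization R {s \<in> carrier R. regular R s} Q f"

(* The existing matrix ring ring_mat takes its entries from a type of class semiring_1.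
   Here the entries come from the carrier of an arbitrary HOL-Algebra ring, while the
   underlying matrix type (rows and columns indexed by 0..n-1) is the same. *)
definition matrix_ring :: "('a, 'm) ring_scheme \<Rightarrow> nat \<Rightarrow> 'a mat ring" where
  "matrix_ring R n = \<lparr>
     carrier = {A \<in> carrier_mat n n. \<forall>i<n. \<forall>j<n. A $$ (i, j) \<in> carrier R},
     mult = (\<lambda>A B. mat n n (\<lambda>(i, j). \<Oplus>\<^bsub>R\<^esub>k\<in>{..<n}. A $$ (i, k) \<otimes>\<^bsub>R\<^esub> B $$ (k, j))),
     one = mat n n (\<lambda>(i, j). if i = j then \<one>\<^bsub>R\<^esub> else \<zero>\<^bsub>R\<^esub>),
     zero = mat n n (\<lambda>(i, j). \<zero>\<^bsub>R\<^esub>),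
     add = (\<lambda>A B. mat n n (\<lambda>(i, j). A $$ (i, j) \<oplus>\<^bsub>R\<^esub> B $$ (i, j)))\<rparr>"

lemma (in ring) finsum_swap:
  assumes "finite A" "finite B" "\<And>i j. i \<in> A \<Longrightarrow> j \<in> B \<Longrightarrow> f i j \<in> carrier R"
  shows "(\<Oplus>i\<in>A. \<Oplus>j\<in>B. f i j) = (\<Oplus>j\<in>B. \<Oplus>i\<in>A. f i j)"
  using assms(1,3)
proof (induction A rule: finite_induct)
  case empty
  then show ?case by simp
next
  case (insert x F)
  have 1: "(\<Oplus>i\<in>insert x F. \<Oplus>j\<in>B. f i j) = (\<Oplus>j\<in>B. f x j) \<oplus> (\<Oplus>i\<in>F. \<Oplus>j\<in>B. f i j)"
    using insert by (intro finsum_insert) (auto intro!: finsum_closed)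
  have "(\<Oplus>j\<in>B. \<Oplus>i\<in>insert x F. f i j) = (\<Oplus>j\<in>B. f x j \<oplus> (\<Oplus>i\<in>F. f i j))"
    using insert by (intro finsum_cong') (auto intro!: finsum_closed simp: Pi_def)
  also have "\<dots> = (\<Oplus>j\<in>B. f x j) \<oplus> (\<Oplus>j\<in>B. \<Oplus>i\<in>F. f i j)"
    using insert by (intro finsum_addf) (auto intro!: finsum_closed)
  finally show ?case using 1 insert by simp
qed

lemma (in ring) ring_matrix_ring: "ring (matrix_ring R n)"
proof (rule ringI)
  show "abelian_group (matrix_ring R n)"
  proof (rule abelian_groupI)
    fix A assume A: "A \<in> carrier (matrix_ring R n)"
    show "\<exists>B\<in>carrier (matrix_ring R n).
        B \<oplus>\<^bsub>matrix_ring R n\<^esub> A = \<zero>\<^bsub>matrix_ring R n\<^esub>"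
      using A by (intro bexI[of _ "mat n n (\<lambda>ij. \<ominus> (A $$ ij))"])
        (auto simp: matrix_ring_def l_neg intro!: eq_matI)
  qed (auto simp: matrix_ring_def a_ac intro!: eq_matI)
next
  show "monoid (matrix_ring R n)"
  proof (rule monoidI)
    fix A B C assume ABC: "A \<in> carrier (matrix_ring R n)" "B \<in> carrier (matrix_ring R n)"
      "C \<in> carrier (matrix_ring R n)"
    have "(\<Oplus>k\<in>{..<n}. (\<Oplus>l\<in>{..<n}. A $$ (i, l) \<otimes> B $$ (l, k)) \<otimes> C $$ (k, j)) =
      (\<Oplus>l\<in>{..<n}. A $$ (i, l) \<otimes> (\<Oplus>k\<in>{..<n}. B $$ (l, k) \<otimes> C $$ (k, j)))"
      (is "?l = ?r") if "i < n" "j < n" for i j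
    proof -
      have "?l = (\<Oplus>k\<in>{..<n}. \<Oplus>l\<in>{..<n}. A $$ (i, l) \<otimes> B $$ (l, k) \<otimes> C $$ (k, j))"
        using ABC that
        by (intro finsum_cong') (auto simp: matrix_ring_def finsum_ldistr intro!: finsum_closed)
      also have "\<dots> = (\<Oplus>l\<in>{..<n}. \<Oplus>k\<in>{..<n}. A $$ (i, l) \<otimes> B $$ (l, k) \<otimes> C $$ (k, j))"
        using ABC that by (intro finsum_swap) (auto simp: matrix_ring_def)
      also have "\<dots> = (\<Oplus>l\<in>{..<n}. \<Oplus>k\<in>{..<n}. A $$ (i, l) \<otimes> (B $$ (l, k) \<otimes> C $$ (k, j)))"
        using ABC that
        by (intro finsum_cong') (auto simp: matrix_ring_def m_assoc intro!: finsum_closed finsum_cong')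
      also have "\<dots> = ?r"
        using ABC that
        by (intro finsum_cong') (auto simp: matrix_ring_def finsum_rdistr intro!: finsum_closed)
      finally show ?thesis .
    qed
    then show "A \<otimes>\<^bsub>matrix_ring R n\<^esub> B \<otimes>\<^bsub>matrix_ring R n\<^esub> C =
        A \<otimes>\<^bsub>matrix_ring R n\<^esub> (B \<otimes>\<^bsub>matrix_ring R n\<^esub> C)"
      using ABC by (auto simp: matrix_ring_def intro!: eq_matI cong: finsum_cong)
  next
    fix A assume A: "A \<in> carrier (matrix_ring R n)"
    have "(\<Oplus>k\<in>{..<n}. (if i = k then \<one> else \<zero>) \<otimes> A $$ (k, j)) = A $$ (i, j)"
      if "i < n" "j < n" for i j
    proof -
      have "(\<Oplus>k\<in>{..<n}. (if i = k then \<one> else \<zero>) \<otimes> A $$ (k, j)) =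
          (\<Oplus>k\<in>{..<n}. if i = k then A $$ (k, j) else \<zero>)"
        using A that by (intro finsum_cong') (auto simp: matrix_ring_def)
      also have "\<dots> = A $$ (i, j)"
        using A that by (subst finsum_singleton) (auto simp: matrix_ring_def)
      finally show ?thesis .
    qed
    then show "\<one>\<^bsub>matrix_ring R n\<^esub> \<otimes>\<^bsub>matrix_ring R n\<^esub> A = A"
      using A by (auto simp: matrix_ring_def intro!: eq_matI cong: finsum_cong)
    have "(\<Oplus>k\<in>{..<n}. A $$ (i, k) \<otimes> (if k = j then \<one> else \<zero>)) = A $$ (i, j)"
      if "i < n" "j < n" for i j
    proof -
      have "(\<Oplus>k\<in>{..<n}. A $$ (i, k) \<otimes> (if k = j then \<one> else \<zero>)) =
          (\<Oplus>k\<in>{..<n}. if j = k then A $$ (i, k) else \<zero>)"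
        using A that by (intro finsum_cong') (auto simp: matrix_ring_def)
      also have "\<dots> = A $$ (i, j)"
        using A that by (subst finsum_singleton) (auto simp: matrix_ring_def)
      finally show ?thesis .
    qed
    then show "A \<otimes>\<^bsub>matrix_ring R n\<^esub> \<one>\<^bsub>matrix_ring R n\<^esub> = A"
      using A by (auto simp: matrix_ring_def intro!: eq_matI cong: finsum_cong)
  qed (auto simp: matrix_ring_def intro!: finsum_closed)
next
  fix A B C assume ABC: "A \<in> carrier (matrix_ring R n)" "B \<in> carrier (matrix_ring R n)"
    "C \<in> carrier (matrix_ring R n)"
  have "(\<Oplus>k\<in>{..<n}. (A $$ (i, k) \<oplus> B $$ (i, k)) \<otimes> C $$ (k, j)) =
    (\<Oplus>k\<in>{..<n}. A $$ (i, k) \<otimes> C $$ (k, j)) \<oplus> (\<Oplus>k\<in>{..<n}. B $$ (i, k) \<otimes> C $$ (k, j))"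
    if "i < n" "j < n" for i j
  proof -
    have "(\<Oplus>k\<in>{..<n}. (A $$ (i, k) \<oplus> B $$ (i, k)) \<otimes> C $$ (k, j)) = (\<Oplus>k\<in>{..<n}. A $$ (i, k) \<otimes> C $$ (k, j) \<oplus> B $$ (i, k) \<otimes> C $$ (k, j))"
      using ABC that by (intro finsum_cong'[OF refl]) (simp_all add: matrix_ring_def l_distr Pi_def)
    also have "\<dots> = (\<Oplus>k\<in>{..<n}. A $$ (i, k) \<otimes> C $$ (k, j)) \<oplus> (\<Oplus>k\<in>{..<n}. B $$ (i, k) \<otimes> C $$ (k, j))"
      using ABC that by (intro finsum_addf) (simp_all add: matrix_ring_def Pi_def)
    finally show ?thesis .
  qed
  then show "(A \<oplus>\<^bsub>matrix_ring R n\<^esub> B) \<otimes>\<^bsub>matrix_ring R n\<^esub> C =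
      A \<otimes>\<^bsub>matrix_ring R n\<^esub> C \<oplus>\<^bsub>matrix_ring R n\<^esub> B \<otimes>\<^bsub>matrix_ring R n\<^esub> C"
    using ABC by (auto simp: matrix_ring_def intro!: eq_matI cong: finsum_cong)
  have "(\<Oplus>k\<in>{..<n}. C $$ (i, k) \<otimes> (A $$ (k, j) \<oplus> B $$ (k, j))) =
    (\<Oplus>k\<in>{..<n}. C $$ (i, k) \<otimes> A $$ (k, j)) \<oplus> (\<Oplus>k\<in>{..<n}. C $$ (i, k) \<otimes> B $$ (k, j))"
    if "i < n" "j < n" for i j
  proof -
    have "(\<Oplus>k\<in>{..<n}. C $$ (i, k) \<otimes> (A $$ (k, j) \<oplus> B $$ (k, j))) = (\<Oplus>k\<in>{..<n}. C $$ (i, k) \<otimes> A $$ (k, j) \<oplus> C $$ (i, k) \<otimes> B $$ (k, j))"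
      using ABC that by (intro finsum_cong'[OF refl]) (simp_all add: matrix_ring_def r_distr Pi_def)
    also have "\<dots> = (\<Oplus>k\<in>{..<n}. C $$ (i, k) \<otimes> A $$ (k, j)) \<oplus> (\<Oplus>k\<in>{..<n}. C $$ (i, k) \<otimes> B $$ (k, j))"
      using ABC that by (intro finsum_addf) (simp_all add: matrix_ring_def Pi_def)
    finally show ?thesis .
  qed
  then show "C \<otimes>\<^bsub>matrix_ring R n\<^esub> (A \<oplus>\<^bsub>matrix_ring R n\<^esub> B) =
      C \<otimes>\<^bsub>matrix_ring R n\<^esub> A \<oplus>\<^bsub>matrix_ring R n\<^esub> C \<otimes>\<^bsub>matrix_ring R n\<^esub> B"
    using ABC by (auto simp: matrix_ring_def intro!: eq_matI cong: finsum_cong)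
qed

end

theory Submission
  imports Defs
begin

text \<open>
  A matrix is already left fusible as soon as one of its entries is. Suppose the \<open>(i, j)\<close> entry of
  \<open>A\<close> is \<open>c \<oplus> w\<close> with \<open>c\<close> a left zero-divisor and \<open>w\<close> left regular. Let \<open>W\<close> agree with \<open>A\<close> on row
  \<open>i\<close>, except that its \<open>(i, j)\<close> entry is \<open>w\<close>, and let its remaining rows be the unit rows with
  their \<open>1\<close> in the columns other than \<open>j\<close>, each column used once. Up to permuting rows and
  columns, \<open>W\<close> is upper triangular with diagonal \<open>w, 1, ..., 1\<close>, hence left regular. The difference
  \<open>A - W\<close> has the row \<open>(0, ..., c, ..., 0)\<close> at index \<open>i\<close>, which is killed from the left by
  any \<open>x\<close> with \<open>x c = 0\<close>; hence it is a left zero-divisor. This is \<open>left_fusible_matrixI\<close>.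

  For an arbitrary nonzero \<open>A\<close>, choose a nonzero entry \<open>a\<close> and a regular \<open>s\<close> such that \<open>s a\<close> is left
  fusible. The scalar matrix \<open>s I\<close> is again regular (\<open>regular_scalar_matrix\<close>), and \<open>s A\<close> has the left
  fusible entry \<open>s a\<close>, so \<open>s A\<close> is left fusible.
\<close>

section \<open>Annihilators and matrix entries\<close>

lemma left_regularD:
  assumes "left_regular R a" "x \<in> carrier R" "x \<otimes>\<^bsub>R\<^esub> a = \<zero>\<^bsub>R\<^esub>"
  shows "x = \<zero>\<^bsub>R\<^esub>"
  using assms unfolding left_regular_def lann_def by blast

lemma (in ring) left_regularI:
  assumes "a \<in> carrier R" "\<And>x. x \<in> carrier R \<Longrightarrow> x \<otimes> a = \<zero> \<Longrightarrow> x = \<zero>"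
  shows "left_regular R a"
  using assms unfolding left_regular_def lann_def by auto

lemma (in ring) left_zero_divisorI:
  assumes "a \<in> carrier R" "x \<in> carrier R" "x \<otimes> a = \<zero>" "x \<noteq> \<zero>"
  shows "left_zero_divisor R a"
  using assms unfolding left_zero_divisor_def lann_def by auto

lemma (in ring) left_zero_divisorE:
  assumes "left_zero_divisor R a"
  obtains x where "x \<in> carrier R" "x \<otimes> a = \<zero>" "x \<noteq> \<zero>"
  using assms unfolding left_zero_divisor_def lann_def by auto

context ring
begin

lemma finsum_single_term:
  fixes n :: nat
  assumes "i < n" "g i \<in> carrier R" "\<And>k. k < n \<Longrightarrow> k \<noteq> i \<Longrightarrow> g k = \<zero>"
  shows "(\<Oplus>k\<in>{..<n}. g k) = g i"
proof -
  have "(\<Oplus>k\<in>{..<n}. g k) = (\<Oplus>k\<in>{..<n}. if i = k then g i else \<zero>)"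
    using assms by (intro finsum_cong') auto
  also have "\<dots> = g i"
    using assms by (subst finsum_singleton) auto
  finally show ?thesis .
qed

lemma matrix_ring_carrierI:
  assumes "\<And>i j. i < n \<Longrightarrow> j < n \<Longrightarrow> g i j \<in> carrier R"
  shows "mat n n (\<lambda>(i, j). g i j) \<in> carrier (matrix_ring R n)"
  using assms by (simp add: matrix_ring_def)

lemma matrix_ring_entry:
  assumes "A \<in> carrier (matrix_ring R n)" "i < n" "j < n"
  shows "A $$ (i, j) \<in> carrier R"
  using assms by (simp add: matrix_ring_def)

lemma matrix_ring_eqI:
  assumes "A \<in> carrier (matrix_ring R n)" "B \<in> carrier (matrix_ring R n)"
    "\<And>i j. i < n \<Longrightarrow> j < n \<Longrightarrow> A $$ (i, j) = B $$ (i, j)"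
  shows "A = B"
  using assms by (intro eq_matI) (auto simp: matrix_ring_def)

lemma matrix_ring_zero_entry:
  assumes "i < n" "j < n"
  shows "\<zero>\<^bsub>matrix_ring R n\<^esub> $$ (i, j) = \<zero>"
  using assms by (simp add: matrix_ring_def)

lemma matrix_ring_add_entry:
  assumes "i < n" "j < n"
  shows "(A \<oplus>\<^bsub>matrix_ring R n\<^esub> B) $$ (i, j) = A $$ (i, j) \<oplus> B $$ (i, j)"
  using assms by (simp add: matrix_ring_def)

lemma matrix_ring_mult_entry:
  assumes "i < n" "j < n"
  shows "(A \<otimes>\<^bsub>matrix_ring R n\<^esub> B) $$ (i, j) = (\<Oplus>k\<in>{..<n}. A $$ (i, k) \<otimes> B $$ (k, j))"
  using assms by (simp add: matrix_ring_def)

lemmas matrix_ring_entries = matrix_ring_zero_entry matrix_ring_add_entry matrix_ring_mult_entry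

section \<open>Scalar matrices\<close>

definition scalar_matrix :: "nat \<Rightarrow> 'a \<Rightarrow> 'a mat" where
  "scalar_matrix n s = mat n n (\<lambda>(i, j). if i = j then s else \<zero>)"

lemma scalar_matrix_carrier:
  "s \<in> carrier R \<Longrightarrow> scalar_matrix n s \<in> carrier (matrix_ring R n)"
  unfolding scalar_matrix_def by (rule matrix_ring_carrierI) auto

lemma scalar_matrix_mult_entry:
  assumes "s \<in> carrier R" "A \<in> carrier (matrix_ring R n)" "i < n" "j < n"
  shows "(scalar_matrix n s \<otimes>\<^bsub>matrix_ring R n\<^esub> A) $$ (i, j) = s \<otimes> A $$ (i, j)"
  unfolding matrix_ring_mult_entry[OF assms(3,4)]
  using assms matrix_ring_entry[OF assms(2)]
  by (subst finsum_single_term[of i]) (auto simp: scalar_matrix_def)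

lemma mult_scalar_matrix_entry:
  assumes "s \<in> carrier R" "A \<in> carrier (matrix_ring R n)" "i < n" "j < n"
  shows "(A \<otimes>\<^bsub>matrix_ring R n\<^esub> scalar_matrix n s) $$ (i, j) = A $$ (i, j) \<otimes> s"
  unfolding matrix_ring_mult_entry[OF assms(3,4)]
  using assms matrix_ring_entry[OF assms(2)]
  by (subst finsum_single_term[of j]) (auto simp: scalar_matrix_def)

text \<open>
  Although \<open>s I\<close> is in general not central, multiplying by it on either side acts entry by entry,
  so each half of regularity passes from \<open>s\<close> to \<open>s I\<close> separately.
\<close>
lemma regular_scalar_matrix:
  assumes "regular R s"
  shows "regular (matrix_ring R n) (scalar_matrix n s)"
proof -
  interpret M: ring "matrix_ring R n" by (rule ring_matrix_ring)
  have s: "s \<in> carrier R" and l: "left_regular R s" and r: "right_regular R s"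
    using assms by (auto simp: regular_def left_regular_def)
  note S = scalar_matrix_carrier[OF s, of n]
  have "left_regular (matrix_ring R n) (scalar_matrix n s)"
  proof (rule M.left_regularI[OF S])
    fix X assume X: "X \<in> carrier (matrix_ring R n)"
      and eq: "X \<otimes>\<^bsub>matrix_ring R n\<^esub> scalar_matrix n s = \<zero>\<^bsub>matrix_ring R n\<^esub>"
    show "X = \<zero>\<^bsub>matrix_ring R n\<^esub>"
    proof (rule matrix_ring_eqI[OF X M.zero_closed])
      fix i j assume ij: "i < n" "j < n"
      have "X $$ (i, j) \<otimes> s = \<zero>"
        using mult_scalar_matrix_entry[OF s X ij] eq ij by (simp add: matrix_ring_zero_entry)
      then show "X $$ (i, j) = \<zero>\<^bsub>matrix_ring R n\<^esub> $$ (i, j)"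
        using left_regularD[OF l matrix_ring_entry[OF X ij]] ij by (simp add: matrix_ring_zero_entry)
    qed
  qed
  moreover have "right_regular (matrix_ring R n) (scalar_matrix n s)"
    unfolding right_regular_def
  proof (intro conjI ballI impI S)
    fix X assume X: "X \<in> carrier (matrix_ring R n)"
      and eq: "scalar_matrix n s \<otimes>\<^bsub>matrix_ring R n\<^esub> X = \<zero>\<^bsub>matrix_ring R n\<^esub>"
    show "X = \<zero>\<^bsub>matrix_ring R n\<^esub>"
    proof (rule matrix_ring_eqI[OF X M.zero_closed])
      fix i j assume ij: "i < n" "j < n"
      have "s \<otimes> X $$ (i, j) = \<zero>"
        using scalar_matrix_mult_entry[OF s X ij] eq ij by (simp add: matrix_ring_zero_entry)
      then show "X $$ (i, j) = \<zero>\<^bsub>matrix_ring R n\<^esub> $$ (i, j)"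
        using r matrix_ring_entry[OF X ij] ij
        by (auto simp: matrix_ring_zero_entry right_regular_def)
    qed
  qed
  ultimately show ?thesis by (simp add: regular_def)
qed

section \<open>Fusing a matrix along one entry\<close>

text \<open>
  If \<open>X W = 0\<close>, then column \<open>j\<close> of the product shows that column \<open>i\<close> of \<open>X\<close> vanishes, because there
  \<open>w\<close> is the only nonzero entry of \<open>W\<close>. Once it has vanished, the arbitrary entries of row
  \<open>i\<close> of \<open>W\<close> contribute nothing, and the unit rows expose the other columns of \<open>X\<close> one by one.
\<close>
lemma left_regular_row_replaced_permutation_matrix:
  assumes ij: "i < n" "j < n"
    and p: "bij_betw p {..<n} {..<n}" "p i = j"
    and w: "left_regular R w"
    and a: "\<And>l. l < n \<Longrightarrow> a l \<in> carrier R"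
  shows "left_regular (matrix_ring R n)
    (mat n n (\<lambda>(k, l). if k = i then (if l = j then w else a l) else if l = p k then \<one> else \<zero>))"
    (is "left_regular ?M ?W")
proof -
  interpret M: ring ?M by (rule ring_matrix_ring)
  have w_carrier: "w \<in> carrier R" using w by (simp add: left_regular_def)
  have p_less: "p k < n" if "k < n" for k using p that by (auto simp: bij_betw_def)
  have p_eq: "p k = p l \<longleftrightarrow> k = l" if "k < n" "l < n" for k l
    using p that by (auto simp: bij_betw_def inj_on_def)
  have W: "?W \<in> carrier ?M"
    using w_carrier a by (intro matrix_ring_carrierI) auto
  show ?thesis
  proof (rule M.left_regularI[OF W])
    fix X assume X: "X \<in> carrier ?M" and eq: "X \<otimes>\<^bsub>?M\<^esub> ?W = \<zero>\<^bsub>?M\<^esub>"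
    have sum0: "(\<Oplus>k\<in>{..<n}. X $$ (m, k) \<otimes> ?W $$ (k, l)) = \<zero>" if "m < n" "l < n" for m l
      unfolding matrix_ring_mult_entry[OF that, symmetric] eq by (rule matrix_ring_zero_entry[OF that])
    note entry = matrix_ring_entry[OF X]
    have column_i: "X $$ (m, i) = \<zero>" if m: "m < n" for m
    proof (rule left_regularD[OF w entry[OF m ij(1)]])
      have "(\<Oplus>k\<in>{..<n}. X $$ (m, k) \<otimes> ?W $$ (k, j)) = X $$ (m, i) \<otimes> ?W $$ (i, j)"
        using ij m entry w_carrier p(2) p_eq by (intro finsum_single_term) auto
      then show "X $$ (m, i) \<otimes> w = \<zero>" using sum0[OF m ij(2)] ij by simp
    qed
    show "X = \<zero>\<^bsub>?M\<^esub>"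
    proof (rule matrix_ring_eqI[OF X M.zero_closed])
      fix m k assume m: "m < n" and k: "k < n"
      have "X $$ (m, k) = \<zero>"
      proof (cases "k = i")
        case True
        then show ?thesis using column_i m by simp
      next
        case False
        have "(\<Oplus>l\<in>{..<n}. X $$ (m, l) \<otimes> ?W $$ (l, p k)) = X $$ (m, k) \<otimes> ?W $$ (k, p k)"
        proof (rule finsum_single_term[OF k])
          fix l assume l: "l < n" "l \<noteq> k"
          show "X $$ (m, l) \<otimes> ?W $$ (l, p k) = \<zero>"
          proof (cases "l = i")
            case True
            then show ?thesis
              using column_i[OF m] matrix_ring_entry[OF W l(1) p_less[OF k]] by simp
          next
            case False
            then show ?thesis using l m k p_less p_eq entry by simp
          qed
        qed (use m k p_less entry False in simp)
        then show ?thesis using sum0[OF m p_less[OF k]] m k p_less entry False by simp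
      qed
      then show "X $$ (m, k) = \<zero>\<^bsub>?M\<^esub> $$ (m, k)" using m k by (simp add: matrix_ring_zero_entry)
    qed
  qed
qed

text \<open>
  If \<open>x\<close> is nonzero and annihilates the \<open>(i, j)\<close> entry of \<open>C\<close> from the left, then the matrix whose
  only nonzero entry is \<open>x\<close> at position \<open>(i, i)\<close> picks out row \<open>i\<close> of \<open>C\<close> and multiplies it by
  \<open>x\<close>, which leaves nothing.
\<close>
lemma left_zero_divisor_row:
  assumes C: "C \<in> carrier (matrix_ring R n)" and ij: "i < n" "j < n"
    and c: "left_zero_divisor R (C $$ (i, j))"
    and row: "\<And>l. l < n \<Longrightarrow> l \<noteq> j \<Longrightarrow> C $$ (i, l) = \<zero>"
  shows "left_zero_divisor (matrix_ring R n) C"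
proof -
  interpret M: ring "matrix_ring R n" by (rule ring_matrix_ring)
  obtain x where x: "x \<in> carrier R" "x \<otimes> C $$ (i, j) = \<zero>" "x \<noteq> \<zero>"
    using c by (rule left_zero_divisorE)
  define X where "X = mat n n (\<lambda>(k, l). if k = i \<and> l = i then x else \<zero>)"
  have X: "X \<in> carrier (matrix_ring R n)"
    unfolding X_def using x by (intro matrix_ring_carrierI) auto
  show ?thesis
  proof (rule M.left_zero_divisorI[OF C X])
    show "X \<otimes>\<^bsub>matrix_ring R n\<^esub> C = \<zero>\<^bsub>matrix_ring R n\<^esub>"
    proof (rule matrix_ring_eqI[OF M.m_closed[OF X C] M.zero_closed])
      fix k l assume kl: "k < n" "l < n"
      have xC: "x \<otimes> C $$ (i, l) = \<zero>"
        using x row[OF kl(2)] by (cases "l = j") auto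
      have "(\<Oplus>m\<in>{..<n}. X $$ (k, m) \<otimes> C $$ (m, l)) = X $$ (k, i) \<otimes> C $$ (i, l)"
        using ij kl x matrix_ring_entry[OF C] by (intro finsum_single_term) (auto simp: X_def)
      also have "\<dots> = \<zero>"
        using xC ij kl matrix_ring_entry[OF C] by (auto simp: X_def)
      finally show "(X \<otimes>\<^bsub>matrix_ring R n\<^esub> C) $$ (k, l) = \<zero>\<^bsub>matrix_ring R n\<^esub> $$ (k, l)"
        using kl by (simp add: matrix_ring_entries)
    qed
    have "X $$ (i, i) \<noteq> \<zero>\<^bsub>matrix_ring R n\<^esub> $$ (i, i)"
      using ij x by (simp add: X_def matrix_ring_zero_entry)
    then show "X \<noteq> \<zero>\<^bsub>matrix_ring R n\<^esub>" by auto
  qed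
qed

text \<open>
  Subtracting from \<open>A\<close> a left regular matrix \<open>W\<close> that shares row \<open>i\<close> with it except for \<open>w\<close>
  leaves \<open>c\<close> as the only nonzero entry of that row. One such row already makes the difference a left
  zero-divisor, so the other rows of \<open>W\<close> can be chosen for left regularity alone.
\<close>
lemma left_fusible_matrixI:
  assumes A: "A \<in> carrier (matrix_ring R n)" and ij: "i < n" "j < n"
    and fus: "left_fusible R (A $$ (i, j))"
  shows "left_fusible (matrix_ring R n) A"
proof -
  interpret M: ring "matrix_ring R n" by (rule ring_matrix_ring)
  obtain c w where c: "left_zero_divisor R c" and w: "left_regular R w"
    and cw: "A $$ (i, j) = c \<oplus> w" and nz: "A $$ (i, j) \<noteq> \<zero>"
    using fus unfolding left_fusible_def by blast
  have cw_carrier: "c \<in> carrier R" "w \<in> carrier R"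
    using c w by (auto simp: left_zero_divisor_def left_regular_def)
  note entry = matrix_ring_entry[OF A]
  \<comment> \<open>Any permutation sending \<open>i\<close> to \<open>j\<close> places the unit rows off column \<open>j\<close>.\<close>
  define p where "p = transpose i j"
  have p: "bij_betw p {..<n} {..<n}" "p i = j"
    using ij by (simp_all add: p_def bij_betw_transpose_iff)
  define W where "W = mat n n (\<lambda>(k, l).
    if k = i then (if l = j then w else A $$ (i, l)) else if l = p k then \<one> else \<zero>)"
  have W: "left_regular (matrix_ring R n) W"
    unfolding W_def
    by (rule left_regular_row_replaced_permutation_matrix[OF ij p w]) (use entry ij in auto)
  then have W_carrier: "W \<in> carrier (matrix_ring R n)" by (simp add: left_regular_def)
  define C where "C = mat n n (\<lambda>(k, l).
    if k = i then (if l = j then c else \<zero>) else A $$ (k, l) \<ominus> W $$ (k, l))"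
  have C_carrier: "C \<in> carrier (matrix_ring R n)"
    unfolding C_def using cw_carrier entry matrix_ring_entry[OF W_carrier]
    by (intro matrix_ring_carrierI) auto
  have C: "left_zero_divisor (matrix_ring R n) C"
    by (rule left_zero_divisor_row[OF C_carrier ij]) (use c ij in \<open>auto simp: C_def\<close>)
  have "A = C \<oplus>\<^bsub>matrix_ring R n\<^esub> W"
  proof (rule matrix_ring_eqI[OF A M.add.m_closed[OF C_carrier W_carrier]])
    fix k l assume kl: "k < n" "l < n"
    have "C $$ (k, l) \<oplus> W $$ (k, l) = A $$ (k, l)"
    proof (cases "k = i")
      case True
      then show ?thesis using kl cw entry by (auto simp: C_def W_def)
    next
      case False
      then show ?thesis
        using kl entry[OF kl] matrix_ring_entry[OF W_carrier kl]
        by (simp add: C_def minus_eq a_assoc l_neg)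
    qed
    then show "A $$ (k, l) = (C \<oplus>\<^bsub>matrix_ring R n\<^esub> W) $$ (k, l)"
      using kl by (simp add: matrix_ring_add_entry)
  qed
  moreover have "A \<noteq> \<zero>\<^bsub>matrix_ring R n\<^esub>"
    using nz matrix_ring_zero_entry[OF ij] by auto
  ultimately show ?thesis
    using A C W unfolding left_fusible_def by blast
qed

section \<open>Regular left fusibility of matrix rings\<close>

lemma regular_left_fusible_matrix_ring:
  assumes "regular_left_fusible_ring R"
  shows "regular_left_fusible_ring (matrix_ring R n)"
  unfolding regular_left_fusible_ring_def
proof (intro conjI ballI impI ring_matrix_ring)
  interpret M: ring "matrix_ring R n" by (rule ring_matrix_ring)
  fix A assume A: "A \<in> carrier (matrix_ring R n)" and "A \<noteq> \<zero>\<^bsub>matrix_ring R n\<^esub>"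
  then obtain i j where ij: "i < n" "j < n" and nz: "A $$ (i, j) \<noteq> \<zero>"
    using matrix_ring_eqI[OF A M.zero_closed] by (auto simp: matrix_ring_zero_entry)
  then obtain s where s: "regular R s" and fus: "left_fusible R (s \<otimes> A $$ (i, j))"
    using assms matrix_ring_entry[OF A ij] unfolding regular_left_fusible_ring_def by blast
  have s_carrier: "s \<in> carrier R" using s by (simp add: regular_def left_regular_def)
  have "left_fusible (matrix_ring R n) (scalar_matrix n s \<otimes>\<^bsub>matrix_ring R n\<^esub> A)"
    using fus scalar_matrix_mult_entry[OF s_carrier A ij]
    by (intro left_fusible_matrixI[OF M.m_closed[OF scalar_matrix_carrier[OF s_carrier] A] ij]) simp
  then show "\<exists>S. regular (matrix_ring R n) S \<and>
      left_fusible (matrix_ring R n) (S \<otimes>\<^bsub>matrix_ring R n\<^esub> A)"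
    using regular_scalar_matrix[OF s] by blast
qed

end

theorem theorem2p17:
  fixes R :: "('a, 'm) ring_scheme"
    and Q :: "('q, 'k) ring_scheme"
    and f :: "'a \<Rightarrow> 'q"
    and n :: nat
  assumes "regular_left_fusible_ring R"
    and "classical_left_quotient_ring R Q f"
    and "n \<ge> 1"
  shows "regular_left_fusible_ring (matrix_ring R n)"
proof -
  interpret ring R using assms(1) by (simp add: regular_left_fusible_ring_def)
  show ?thesis using assms(1) by (rule regular_left_fusible_matrix_ring)
qed

end
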